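(* For any fixed bipartite graph $G$ that is not a matching (i.e. $G$ has a vertex of degree at least 2), as $n\to\infty$, $$2^{n-1}+\left(\tfrac{1}{2}-o(1)\right)\binom{n}{\lfloor n/2\rfloor}\le \mathrm{vex}(n,G)\le 2^{n-1}+(1+o(1))\binom{n}{\lfloor n/2\rfloor}.$$
   Context: The Kneser cube $Kn_n$ is the graph with vertex set $2^{[n]}=\{F: F\subseteq\{1,\dots,n\}\}$ in which two distinct vertices $F,F'$ are adjacent if and only if $F\cap F'=\emptyset$. For a graph $G$, $\mathrm{vex}(n,G)$ is the maximum size of a family $\mathcal{F}\subseteq 2^{[n]}$ such that the induced subgraph $Kn_n[\mathcal{F}]$ contains no subgraph isomorphic to $G$. *)

theory Defs
  imports Complex_Main "HOL-Library.Landau_Symbols" "Graph_Theory.Graph_Theory"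
begin

(* A finite simple graph is a pair_graph: a finite, loop-free digraph with symmetric arc set,
   so that each undirected edge uv is represented by the two arcs (u,v) and (v,u), and
   out_degree is the usual degree. *)

definition bipartite :: "'a pair_pre_digraph \<Rightarrow> bool" where
  "bipartite G \<longleftrightarrow> (\<exists>U V. pverts G = U \<union> V \<and> U \<inter> V = {} \<and> parcs G \<subseteq> U \<times> V \<union> V \<times> U)"

definition kneser_cube :: "nat \<Rightarrow> nat set pair_pre_digraph" where
  "kneser_cube n =
     \<lparr>pverts = Pow {1..n},
      parcs = {(A, B). A \<subseteq> {1..n} \<and> B \<subseteq> {1..n} \<and> A \<noteq> B \<and> A \<inter> B = {}}\<rparr>"

(* Not necessarily induced. If G is symmetric, then so is every H isomorphic to it, hence
   quantifying over sub-digraphs H agrees with quantifying over subgraphs. *)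
definition contains_copy :: "('b, 'd) pre_digraph \<Rightarrow> ('a, 'c) pre_digraph \<Rightarrow> bool" where
  "contains_copy K G \<longleftrightarrow> (\<exists>H. subgraph H K \<and> digraph_iso G H)"

(* If G has at least one vertex, the empty family is admissible, so that the maximum is
   taken over a nonempty finite set. *)
definition vex :: "nat \<Rightarrow> 'a pair_pre_digraph \<Rightarrow> nat" where
  "vex n G = Max (card ` {\<F>. \<F> \<subseteq> Pow {1..n} \<and>
                    \<not> contains_copy (with_proj (kneser_cube n) \<restriction> \<F>) (with_proj G)})"

end

theory Submission
  imports Defs "HOL-Real_Asymp.Real_Asymp"
begin

text \<open>
  Lower bound: among the sets of size at least \<open>n/2\<close> only complementary pairs are disjoint; for
  odd \<open>n = 2k + 1\<close> an intersecting family of \<open>k\<close>-sets can be added without creating a vertex of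
  degree two.

  Upper bound: a family with \<open>2\<^sup>n\<^sup>-\<^sup>1 + x\<close> members contains at least \<open>2x\<close> sets \<open>F\<close> whose complement
  also belongs to it. If such an \<open>F\<close> has \<open>s\<close> subsets and \<open>s\<close> supersets of the same kind, then the
  subsets and the complements of the supersets form a \<open>K\<^sub>s\<^sub>,\<^sub>s\<close>. Otherwise \<open>F\<close> or its complement
  has few such supersets, and a family in which every set has boundedly many supersets behaves
  asymptotically like an antichain: on a random maximal chain, the number of members is at most one
  plus the number of comparable pairs of members, and the latter has negligible expectation.
\<close>

section \<open>Families with few comparable pairs\<close>

text \<open>Double counting: \<open>x\<close> occurs once for each of the \<open>n - k\<close>
  elements of \<open>S\<close> outside \<open>g x\<close>, where \<open>n = card S\<close> and
  \<open>k = card (g x)\<close>, and \<open>(n - k) * (n choose k) = n * (n - 1 choose k)\<close>.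
  The general \<open>g\<close> and \<open>c\<close> serve both single members (\<open>g\<close> the
  identity) and comparable pairs (\<open>g = snd\<close>, with the weight of the smaller set in
  \<open>c\<close>).\<close>

lemma sum_inverse_choose_delete_element:
  fixes c :: "'b \<Rightarrow> real" and g :: "'b \<Rightarrow> 'a set"
  assumes S: "finite S" and X: "finite X" and sub: "\<And>x. x \<in> X \<Longrightarrow> g x \<subset> S"
  shows "(\<Sum>x\<in>X. c x / (card S choose card (g x))) =
    (\<Sum>i\<in>S. \<Sum>x | x \<in> X \<and> i \<notin> g x. c x / (card (S - {i}) choose card (g x))) / card S"
proof -
  let ?n = "card S"
  have n0: "?n > 0" if "x \<in> X" for x
    using sub[OF that] S by (metis card_gt_0_iff psubset_eq subset_empty)
  have "(\<Sum>i\<in>S. \<Sum>x | x \<in> X \<and> i \<notin> g x. c x / (card (S - {i}) choose card (g x))) =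
      (\<Sum>i\<in>S. \<Sum>x | x \<in> X \<and> i \<notin> g x. c x / (?n - 1 choose card (g x)))"
    by (intro sum.cong refl) (simp add: S)
  also have "\<dots> = (\<Sum>x\<in>X. \<Sum>i | i \<in> S \<and> i \<notin> g x. c x / (?n - 1 choose card (g x)))"
    using S X by (rule sum.swap_restrict)
  also have "\<dots> = (\<Sum>x\<in>X. ?n * (c x / (?n choose card (g x))))"
  proof (rule sum.cong[OF refl])
    fix x assume x: "x \<in> X"
    have le: "card (g x) < ?n"
      using sub[OF x] S by (rule psubset_card_mono[rotated])
    have "{i. i \<in> S \<and> i \<notin> g x} = S - g x" by auto
    then have c: "card {i. i \<in> S \<and> i \<notin> g x} = ?n - card (g x)"
      using sub[OF x] S by (metis card_Diff_subset finite_subset psubset_imp_subset)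
    have "real (?n - card (g x)) * real (?n choose card (g x)) =
        real ?n * real (?n - 1 choose card (g x))"
      using binomial_absorb_comp[of ?n "card (g x)"] by (metis of_nat_mult)
    moreover have "real (?n choose card (g x)) > 0" "real (?n - 1 choose card (g x)) > 0"
      using le by auto
    ultimately show "(\<Sum>i | i \<in> S \<and> i \<notin> g x. c x / (?n - 1 choose card (g x))) =
        ?n * (c x / (?n choose card (g x)))"
      by (simp add: c field_simps)
  qed
  also have "\<dots> = ?n * (\<Sum>x\<in>X. c x / (?n choose card (g x)))"
    by (simp add: sum_distrib_left)
  finally show ?thesis
    using n0 by (cases "X = {}") auto
qed

text \<open>The two sums are the expected numbers of members and of comparable pairs of members on a
  random maximal chain; the induction conditions on the second largest set of the chain.\<close>

lemma LYM_comparable_pairs: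
  assumes "finite S" and "H \<subseteq> Pow S"
  shows "(\<Sum>F\<in>H. 1 / (card S choose card F)) \<le>
    1 + (\<Sum>(A, B) | A \<in> H \<and> B \<in> H \<and> A \<subset> B.
           1 / (real (card B choose card A) * (card S choose card B)))"
  using assms
proof (induction "card S" arbitrary: S H)
  case 0
  then show ?case
    by (cases "H = {}") (auto simp: subset_singleton_iff intro!: sum_nonneg)
next
  case (Suc k)
  let ?n = "card S"
  let ?P = "{(A, B). A \<in> H \<and> B \<in> H \<and> A \<subset> B}"
  have finH: "finite H" using Suc.prems finite_subset by blast
  have finP: "finite ?P"
    by (rule finite_subset[of _ "H \<times> H"]) (use finH in auto)
  show ?case
  proof (cases "S \<in> H")
    case True
    \<comment> \<open>Every maximal chain ends in \<open>S\<close>, so each further member on it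
      forms a pair with \<open>S\<close>. These pairs alone carry the weight of
      \<open>H - {S}\<close>, and \<open>S\<close> itself has weight 1.\<close>
    let ?T = "(\<lambda>A. (A, S)) ` (H - {S})"
    have "?T \<subseteq> ?P" using Suc.prems True by auto
    then have "(\<Sum>(A, B)\<in>?T. 1 / (real (card B choose card A) * (?n choose card B))) \<le>
        (\<Sum>(A, B)\<in>?P. 1 / (real (card B choose card A) * (?n choose card B)))"
      by (intro sum_mono2 finP) auto
    moreover have "(\<Sum>(A, B)\<in>?T. 1 / (real (card B choose card A) * (?n choose card B))) =
        (\<Sum>A\<in>H - {S}. 1 / (?n choose card A))"
      by (subst sum.reindex) (auto simp: inj_on_def)
    moreover have "(\<Sum>F\<in>H. 1 / (?n choose card F)) = 1 + (\<Sum>A\<in>H - {S}. 1 / (?n choose card A))"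
      using sum.remove[OF finH True, of "\<lambda>F. 1 / real (?n choose card F)"] by simp
    ultimately show ?thesis by simp
  next
    case False
    have sub: "F \<subset> S" if "F \<in> H" for F using that False Suc.prems by auto
    have subP: "snd x \<subset> S" if "x \<in> ?P" for x using that by (cases x) (simp add: sub)
    have "(\<Sum>F\<in>H. 1 / (?n choose card F)) =
        (\<Sum>i\<in>S. \<Sum>F | F \<in> H \<and> i \<notin> F. 1 / (card (S - {i}) choose card F)) / ?n"
      using sum_inverse_choose_delete_element[where g = "\<lambda>F. F" and c = "\<lambda>_. 1", OF Suc.prems(1) finH sub]
      by simp
    also have "\<dots> \<le> (\<Sum>i\<in>S. 1 + (\<Sum>x | x \<in> ?P \<and> i \<notin> snd x.
        (1 / real (card (snd x) choose card (fst x))) / (card (S - {i}) choose card (snd x)))) / ?n"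
    proof (intro divide_right_mono sum_mono)
      fix i assume i: "i \<in> S"
      have "(\<Sum>F | F \<in> H \<and> i \<notin> F. 1 / real (card (S - {i}) choose card F)) \<le>
        1 + (\<Sum>(A, B) | A \<in> {F. F \<in> H \<and> i \<notin> F} \<and> B \<in> {F. F \<in> H \<and> i \<notin> F} \<and> A \<subset> B.
           1 / (real (card B choose card A) * (card (S - {i}) choose card B)))"
        by (rule Suc.hyps) (use Suc i in auto)
      \<comment> \<open>Since \<open>A\<close> is a subset of \<open>B\<close>, a pair avoids
        \<open>i\<close> as soon as its larger set does.\<close>
      also have "{(A, B). A \<in> {F. F \<in> H \<and> i \<notin> F} \<and> B \<in> {F. F \<in> H \<and> i \<notin> F} \<and> A \<subset> B} =
          {x. x \<in> ?P \<and> i \<notin> snd x}"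
        by auto
      finally show "(\<Sum>F | F \<in> H \<and> i \<notin> F. 1 / real (card (S - {i}) choose card F)) \<le>
          1 + (\<Sum>x | x \<in> ?P \<and> i \<notin> snd x.
        (1 / real (card (snd x) choose card (fst x))) / (card (S - {i}) choose card (snd x)))"
        by (simp add: case_prod_beta)
    qed simp
    also have "\<dots> = 1 + (\<Sum>i\<in>S. \<Sum>x | x \<in> ?P \<and> i \<notin> snd x.
        (1 / real (card (snd x) choose card (fst x))) / (card (S - {i}) choose card (snd x))) / ?n"
      using Suc.hyps(2) by (simp add: sum.distrib add_divide_distrib del: divide_divide_eq_left)
    also have "\<dots> = 1 + (\<Sum>x\<in>?P. (1 / real (card (snd x) choose card (fst x))) / (?n choose card (snd x)))"
      by (subst sum_inverse_choose_delete_element[where g = snd, OF Suc.prems(1) finP subP]) auto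
    finally show ?thesis by (simp add: case_prod_beta)
  qed
qed

lemma le_choose:
  assumes "0 < k" "k < n"
  shows "n \<le> n choose k"
proof -
  have "n choose 1 \<le> n choose k" if "k \<le> n div 2" "0 < k" for k
    by (rule binomial_mono) (use that in auto)
  from this[of k] this[of "n - k"] show ?thesis
    using assms binomial_symmetric[of k n] by (cases "k \<le> n div 2") auto
qed

text \<open>The pair \<open>(A, B)\<close> has the weight of \<open>A\<close> divided by
  \<open>(n - card A) choose (card B - card A)\<close>. By the size condition this binomial is not
  an extreme one, hence at least \<open>n - card A\<close>, which is at least \<open>s + t\<close>.
  With at most \<open>s\<close> pairs above each \<open>A\<close>, the total weight \<open>W\<close>
  satisfies \<open>W \<le> 1 + s / (s + t) * W\<close>, that is \<open>W \<le> 1 + s / t\<close>,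
  while each member has weight at least the inverse of the central binomial.\<close>

lemma card_few_supersets:
  assumes S: "finite S" and H: "H \<subseteq> Pow S"
    and size: "\<And>F. F \<in> H \<Longrightarrow> card F + (s + t) \<le> card S"
    and few: "\<And>F. F \<in> H \<Longrightarrow> card {B \<in> H. F \<subset> B} \<le> s"
    and t: "t > 0"
  shows "card H \<le> (1 + s / t) * (card S choose (card S div 2))"
proof -
  let ?n = "card S"
  let ?W = "\<Sum>F\<in>H. 1 / real (?n choose card F)"
  have finH: "finite H" using S H finite_subset by blast
  have bound: "1 / (real (card B choose card A) * (?n choose card B)) \<le>
      1 / (?n choose card A) * (1 / (s + t))" if "A \<in> H" "B \<in> H" "A \<subset> B" for A B
  proof -
    have lt: "card A < card B" "card B + (s + t) \<le> ?n"
      using that H S size by (auto intro!: psubset_card_mono elim: finite_subset)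
    have "s + t \<le> ?n - card A" using lt by simp
    also have "\<dots> \<le> (?n - card A) choose (card B - card A)"
      by (rule le_choose) (use lt t in auto)
    finally have "(s + t) * (?n choose card A) \<le> (?n choose card B) * (card B choose card A)"
      using choose_mult[of "card A" "card B" ?n] lt by (simp add: mult.commute)
    then have le: "real (s + t) * real (?n choose card A) \<le>
        real (?n choose card B) * real (card B choose card A)"
      by (metis of_nat_le_iff of_nat_mult)
    have "real (s + t) * real (?n choose card A) > 0" using t lt by simp
    then have "1 / (real (?n choose card B) * real (card B choose card A)) \<le>
        1 / (real (s + t) * real (?n choose card A))"
      using le by (intro divide_left_mono) auto
    then show ?thesis by (simp add: mult.commute)
  qed
  have "(\<Sum>(A, B) | A \<in> H \<and> B \<in> H \<and> A \<subset> B.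
           1 / (real (card B choose card A) * (?n choose card B))) =
      (\<Sum>A\<in>H. \<Sum>B | B \<in> H \<and> A \<subset> B. 1 / (real (card B choose card A) * (?n choose card B)))"
    using finH by (subst sum.Sigma) (auto intro!: sum.cong)
  also have "\<dots> \<le> (\<Sum>A\<in>H. \<Sum>B | B \<in> H \<and> A \<subset> B. 1 / (?n choose card A) * (1 / (s + t)))"
    by (intro sum_mono) (use bound in auto)
  also have "\<dots> = (\<Sum>A\<in>H. card {B \<in> H. A \<subset> B} * (1 / (?n choose card A) * (1 / (s + t))))"
    by simp
  also have "\<dots> \<le> (\<Sum>A\<in>H. s * (1 / (?n choose card A) * (1 / (s + t))))"
    by (intro sum_mono mult_right_mono) (use few in auto)
  also have "\<dots> = s / (s + t) * ?W"
    by (simp add: sum_distrib_left mult.commute)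
  finally have "?W \<le> 1 + s / (s + t) * ?W"
    using LYM_comparable_pairs[OF S H] by linarith
  then have "?W \<le> 1 + s / t"
    using t by (simp add: field_simps)
  moreover have "card H / (?n choose (?n div 2)) \<le> ?W"
  proof -
    have "card H / (?n choose (?n div 2)) = (\<Sum>F\<in>H. 1 / real (?n choose (?n div 2)))"
      by simp
    also have "\<dots> \<le> ?W"
    proof (intro sum_mono divide_left_mono)
      fix F assume "F \<in> H"
      then have "card F \<le> ?n" using size by fastforce
      then show "0 < real (?n choose (?n div 2)) * real (?n choose card F)" by simp
    qed (use binomial_maximum in auto)
    finally show ?thesis .
  qed
  ultimately have "card H / (?n choose (?n div 2)) \<le> 1 + s / t" by linarith
  then show ?thesis by (simp add: pos_divide_le_eq)
qed

section \<open>Copies of graphs in the Kneser cube\<close>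

lemma contains_copy_kneser_cubeI:
  assumes G: "pair_graph G" and F: "\<F> \<subseteq> Pow {1..n}"
    and h: "inj_on h (pverts G)" "h ` pverts G \<subseteq> \<F>"
    and disj: "\<And>u v. (u, v) \<in> parcs G \<Longrightarrow> h u \<inter> h v = {}"
  shows "contains_copy (with_proj (kneser_cube n) \<restriction> \<F>) (with_proj G)"
proof -
  interpret pair_graph G by fact
  \<comment> \<open>Arcs are pairs of vertices, so \<open>h\<close> acts on them componentwise; head
    and tail remain \<open>snd\<close> and \<open>fst\<close>, which makes the image compatible with
    the Kneser cube.\<close>
  define f where "f = \<lparr>iso_verts = h, iso_arcs = map_prod h h, iso_head = snd, iso_tail = fst\<rparr>"
  have iso: "pre_digraph.digraph_isomorphism (with_proj G) f"
    unfolding pre_digraph.digraph_isomorphism_def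
  proof (intro conjI)
    show "wf_digraph (with_proj G)" by unfold_locales
    show "inj_on (iso_arcs f) (arcs (with_proj G))"
    proof -
      have "parcs G \<subseteq> pverts G \<times> pverts G" by (auto dest: in_arcsD1 in_arcsD2)
      with map_prod_inj_on[OF h(1) h(1)] show ?thesis by (auto simp: f_def intro: inj_on_subset)
    qed
  qed (use h in \<open>auto simp: f_def\<close>)
  have neq: "h u \<noteq> h v" if "(u, v) \<in> parcs G" for u v
    using that h(1) no_loops by (metis (no_types, lifting) fst_conv in_arcsD1 in_arcsD2 inj_onD snd_conv)
  have "subgraph (app_iso f (with_proj G)) (with_proj (kneser_cube n) \<restriction> \<F>)"
    unfolding subgraph_def
  proof (intro conjI)
    show "wf_digraph (app_iso f (with_proj G))"
      using iso by (rule wf_digraphI_app_iso)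
    show "wf_digraph (with_proj (kneser_cube n) \<restriction> \<F>)"
      by unfold_locales auto
    show "arcs (app_iso f (with_proj G)) \<subseteq> arcs (with_proj (kneser_cube n) \<restriction> \<F>)"
    proof
      fix e assume "e \<in> arcs (app_iso f (with_proj G))"
      then obtain u v where uv: "(u, v) \<in> parcs G" "e = (h u, h v)" by (auto simp: f_def)
      then have "h u \<in> \<F>" "h v \<in> \<F>" using h(2) in_arcsD1 in_arcsD2 by blast+
      then show "e \<in> arcs (with_proj (kneser_cube n) \<restriction> \<F>)"
        using uv F disj[OF uv(1)] neq[OF uv(1)] by (auto simp: kneser_cube_def)
    qed
  qed (use h in \<open>auto simp: f_def compatible_def\<close>)
  then show ?thesis
    unfolding contains_copy_def digraph_iso_def using iso by blast
qed

text \<open>The only trace of \<open>G\<close> that the lower bound has to exclude: a member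
  disjoint from two different other members. It arises from two arcs leaving \<open>v\<close>, whose
  images share their tail and, being distinct pairs, differ in their heads.\<close>

lemma contains_copy_degree_two:
  assumes "contains_copy (with_proj (kneser_cube n) \<restriction> \<F>) (with_proj G)"
    and v: "v \<in> pverts G" "out_degree (with_proj G) v \<ge> 2"
  obtains X Y Z where "X \<in> \<F>" "Y \<in> \<F>" "Z \<in> \<F>" "Y \<noteq> Z" "X \<noteq> Y" "X \<noteq> Z"
    "X \<inter> Y = {}" "X \<inter> Z = {}"
proof -
  obtain f where sub: "subgraph (app_iso f (with_proj G)) (with_proj (kneser_cube n) \<restriction> \<F>)"
    and iso: "pre_digraph.digraph_isomorphism (with_proj G) f"
    using assms(1) by (auto simp: contains_copy_def digraph_iso_def)
  obtain e1 e2 where e: "e1 \<in> out_arcs (with_proj G) v" "e2 \<in> out_arcs (with_proj G) v" "e1 \<noteq> e2"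
    using v(2) unfolding out_degree_def
    by (metis card_le_Suc0_iff_eq card.infinite not_less_eq_eq numeral_2_eq_2 zero_le)
  let ?g = "iso_arcs f"
  have arcs: "e1 \<in> parcs G" "e2 \<in> parcs G" and tails: "fst e1 = v" "fst e2 = v"
    using e by (auto simp: out_arcs_def)
  have g: "?g e1 \<in> parcs (kneser_cube n)" "?g e2 \<in> parcs (kneser_cube n)"
      "fst (?g e1) \<in> \<F>" "snd (?g e1) \<in> \<F>" "snd (?g e2) \<in> \<F>"
    using sub arcs by (auto simp: subgraph_def)
  have "iso_tail f = fst" using sub by (simp add: subgraph_def compatible_def)
  then have "fst (?g e1) = fst (?g e2)"
    using pre_digraph.iso_verts_tail[OF iso, of e1] pre_digraph.iso_verts_tail[OF iso, of e2]
      arcs tails by simp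
  moreover have "?g e1 \<noteq> ?g e2"
    using pre_digraph.iso_arcs_eq_iff[OF iso] arcs e(3) by simp
  ultimately have "snd (?g e1) \<noteq> snd (?g e2)" by (simp add: prod_eq_iff)
  moreover have "fst e \<noteq> snd e \<and> fst e \<inter> snd e = {}" if "e \<in> parcs (kneser_cube n)" for e
    using that by (cases e) (simp add: kneser_cube_def)
  ultimately show thesis
    using that[of "fst (?g e1)" "snd (?g e1)" "snd (?g e2)"] g \<open>fst (?g e1) = fst (?g e2)\<close>
    by metis
qed

lemma finite_families: "finite {\<F>. \<F> \<subseteq> Pow {1..n::nat} \<and> P \<F>}"
  by (rule finite_subset[of _ "Pow (Pow {1..n})"]) auto

lemma card_le_vex:
  assumes "\<F> \<subseteq> Pow {1..n}" "\<not> contains_copy (with_proj (kneser_cube n) \<restriction> \<F>) (with_proj G)"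
  shows "card \<F> \<le> vex n G"
  unfolding vex_def by (rule Max_ge) (use assms finite_families in auto)

lemma vex_attained:
  assumes "pverts G \<noteq> {}"
  obtains \<F> where "\<F> \<subseteq> Pow {1..n}" "card \<F> = vex n G"
    "\<not> contains_copy (with_proj (kneser_cube n) \<restriction> \<F>) (with_proj G)"
proof -
  have "\<not> contains_copy (with_proj (kneser_cube n) \<restriction> {}) (with_proj G)"
    using assms by (auto simp: contains_copy_def digraph_iso_def subgraph_def)
  then have "vex n G \<in> card ` {\<F>. \<F> \<subseteq> Pow {1..n} \<and>
      \<not> contains_copy (with_proj (kneser_cube n) \<restriction> \<F>) (with_proj G)}"
    unfolding vex_def by (intro Max_in finite_imageI finite_families) blast
  then show thesis using that by auto
qed

text \<open>Inclusion-exclusion for the family and its image under complementation. The lower bound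
  applies it when the union is the whole power set, the upper bound when the union has at most
  \<open>2 ^ n\<close> elements.\<close>

lemma two_card_family:
  assumes S: "finite S" and A: "\<A> \<subseteq> Pow S"
  shows "2 * card \<A> = card (\<A> \<union> (\<lambda>A. S - A) ` \<A>) + card {A \<in> \<A>. S - A \<in> \<A>}"
proof -
  have fin: "finite \<A>" using S A finite_subset by blast
  have inj: "inj_on (\<lambda>A. S - A) \<A>" using A by (auto simp: inj_on_def)
  have "\<A> \<inter> (\<lambda>A. S - A) ` \<A> = {A \<in> \<A>. S - A \<in> \<A>}"
  proof (intro equalityI subsetI)
    fix B assume B: "B \<in> {A \<in> \<A>. S - A \<in> \<A>}"
    then have "B = S - (S - B)" using A by auto
    then show "B \<in> \<A> \<inter> (\<lambda>A. S - A) ` \<A>" using B by blast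
  next
    fix B assume "B \<in> \<A> \<inter> (\<lambda>A. S - A) ` \<A>"
    then obtain A' where "B \<in> \<A>" "A' \<in> \<A>" "B = S - A'" by blast
    moreover from this have "S - B = A'" using A by auto
    ultimately show "B \<in> {A \<in> \<A>. S - A \<in> \<A>}" by simp
  qed
  then show ?thesis
    using card_Un_Int[OF fin finite_imageI[OF fin], of "\<lambda>A. S - A"] card_image[OF inj] by simp
qed

section \<open>The lower bound\<close>

text \<open>In the family of all sets of size at least \<open>k\<close>, disjoint members are
  complementary, so each member is disjoint from at most one other. Both halves of a complementary
  pair belong to it exactly in the middle layer.\<close>

lemma vex_lower_even:
  assumes n: "n = 2 * k" and v: "v \<in> pverts G" "out_degree (with_proj G) v \<ge> 2"
  shows "2 ^ n + (n choose k) \<le> 2 * vex n G"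
proof -
  define \<F> where "\<F> = {F \<in> Pow {1..n}. k \<le> card F}"
  have fin: "finite F" if "F \<in> \<F>" for F
    using that by (auto simp: \<F>_def dest: finite_subset)
  have compl: "Y = {1..n} - X" if "X \<in> \<F>" "Y \<in> \<F>" "X \<inter> Y = {}" for X Y
  proof (rule card_seteq)
    show "card ({1..n} - X) \<le> card Y"
      using that fin[OF that(1)] n by (auto simp: \<F>_def card_Diff_subset)
  qed (use that in \<open>auto simp: \<F>_def\<close>)
  have "\<not> contains_copy (with_proj (kneser_cube n) \<restriction> \<F>) (with_proj G)"
    using v compl by (metis contains_copy_degree_two)
  then have le: "card \<F> \<le> vex n G"
    by (intro card_le_vex) (auto simp: \<F>_def)
  have cc: "card ({1..n} - F) = n - card F" if "F \<subseteq> {1..n}" for F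
    using that by (simp add: card_Diff_subset finite_subset)
  have "\<F> \<union> (\<lambda>A. {1..n} - A) ` \<F> = Pow {1..n}"
  proof
    show "Pow {1..n} \<subseteq> \<F> \<union> (\<lambda>A. {1..n} - A) ` \<F>"
    proof
      fix F assume F: "F \<in> Pow {1..n}"
      then have "F \<in> \<F> \<or> {1..n} - F \<in> \<F>" using cc[of F] n by (auto simp: \<F>_def)
      moreover have "F = {1..n} - ({1..n} - F)" using F by auto
      ultimately show "F \<in> \<F> \<union> (\<lambda>A. {1..n} - A) ` \<F>" by blast
    qed
  qed (auto simp: \<F>_def)
  moreover have "{A \<in> \<F>. {1..n} - A \<in> \<F>} = {A. A \<subseteq> {1..n} \<and> card A = k}"
  proof -
    have "k \<le> card ({1..n} - A) \<longleftrightarrow> card A \<le> k" if "A \<subseteq> {1..n}" for A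
      using cc[OF that] card_mono[OF _ that] n by auto
    then show ?thesis by (auto simp: \<F>_def)
  qed
  moreover have "\<F> \<subseteq> Pow {1..n}" by (auto simp: \<F>_def)
  ultimately have "2 * card \<F> = 2 ^ n + (n choose k)"
    using two_card_family[of "{1..n}" \<F>] n_subsets[of "{1..n}" k] by (simp add: card_Pow)
  with le show ?thesis by simp
qed

text \<open>The sets larger than \<open>k\<close> contain exactly one of each complementary pair,
  which gives \<open>2 ^ (n - 1)\<close>. The \<open>k\<close>-sets through the point 1 are added;
  the loss \<open>n - 1 choose k\<close> counts the \<open>k\<close>-sets that miss 1.\<close>

lemma vex_lower_odd:
  assumes n: "n = 2 * k + 1" and v: "v \<in> pverts G" "out_degree (with_proj G) v \<ge> 2"
  shows "2 ^ (n - 1) + (n choose k) \<le> vex n G + (n - 1 choose k)"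
proof -
  define L where "L = {F \<in> Pow {1..n}. k < card F}"
  define M where "M = {F. F \<subseteq> {1..n} \<and> card F = k}"
  define M' where "M' = {F. F \<subseteq> {2..n} \<and> card F = k}"
  define \<F> where "\<F> = L \<union> (M - M')"
  have cc: "card ({1..n} - F) = n - card F" if "F \<subseteq> {1..n}" for F
    using that by (simp add: card_Diff_subset finite_subset)
  have one: "1 \<in> F" if "F \<in> M - M'" for F
  proof (rule ccontr)
    assume "1 \<notin> F"
    then have "x \<in> {2..n}" if "x \<in> F" for x
      using that \<open>F \<in> M - M'\<close> by (cases "x = 1") (force simp: M_def)+
    then show False using that by (auto simp: M_def M'_def)
  qed
  have compl: "Y = {1..n} - X" if X: "X \<in> \<F>" and Y: "Y \<in> \<F>" and d: "X \<inter> Y = {}" for X Y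
  proof (rule card_seteq)
    have sub: "X \<subseteq> {1..n}" "Y \<subseteq> {1..n}" using X Y by (auto simp: \<F>_def L_def M_def)
    then show "Y \<subseteq> {1..n} - X" using d by auto
    \<comment> \<open>Two \<open>k\<close>-sets of the family meet in 1, so at least one of
      \<open>X\<close>, \<open>Y\<close> has more than \<open>k\<close> elements and the sizes add
      up to at least \<open>2 * k + 1 = n\<close>.\<close>
    have "\<not> (X \<in> M - M' \<and> Y \<in> M - M')" using one d by blast
    then have "n \<le> card X + card Y" using X Y n by (auto simp: \<F>_def L_def M_def)
    then show "card ({1..n} - X) \<le> card Y" using cc sub by simp
  qed simp
  have "\<not> contains_copy (with_proj (kneser_cube n) \<restriction> \<F>) (with_proj G)"
    using v compl by (metis contains_copy_degree_two)
  then have le: "card \<F> \<le> vex n G"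
    by (intro card_le_vex) (auto simp: \<F>_def L_def M_def)
  have "L \<union> (\<lambda>A. {1..n} - A) ` L = Pow {1..n}"
  proof
    show "Pow {1..n} \<subseteq> L \<union> (\<lambda>A. {1..n} - A) ` L"
    proof
      fix F assume F: "F \<in> Pow {1..n}"
      then have "F \<in> L \<or> {1..n} - F \<in> L" using cc[of F] n by (auto simp: L_def)
      moreover have "F = {1..n} - ({1..n} - F)" using F by auto
      ultimately show "F \<in> L \<union> (\<lambda>A. {1..n} - A) ` L" by blast
    qed
  qed (auto simp: L_def)
  moreover have "{A \<in> L. {1..n} - A \<in> L} = {}"
    using cc n by (auto simp: L_def)
  moreover have "L \<subseteq> Pow {1..n}" by (auto simp: L_def)
  ultimately have "2 * card L = 2 ^ n"
    using two_card_family[of "{1..n}" L] by (simp only:) (simp add: card_Pow)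
  then have L: "card L = 2 ^ (n - 1)" using n by simp
  have fin: "finite L" "finite M" "finite M'"
    by (auto simp: L_def M_def M'_def intro: finite_subset[of _ "Pow {1..n}"])
  have "M' \<subseteq> M" by (force simp: M_def M'_def)
  then have "card M = card (M - M') + card M'"
    using fin by (simp add: card_Diff_subset card_mono)
  moreover have "card M = n choose k" "card M' = n - 1 choose k"
    using n_subsets[of "{1..n}" k] n_subsets[of "{2..n}" k] by (simp_all add: M_def M'_def)
  moreover have "card \<F> = card L + card (M - M')"
    unfolding \<F>_def using fin by (intro card_Un_disjoint) (auto simp: L_def M_def)
  ultimately show ?thesis using L le by simp
qed

text \<open>The error term \<open>1 / (2 * n)\<close> comes from odd \<open>n = 2 * k + 1\<close>,
  where \<open>n - 1 choose k\<close> is the fraction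
  \<open>(k + 1) / n = 1 / 2 + 1 / (2 * n)\<close> of \<open>n choose k\<close>; even
  \<open>n\<close> gives the full \<open>1 / 2\<close>.\<close>

lemma vex_lower:
  assumes n: "n \<ge> 1" and v: "v \<in> pverts G" "out_degree (with_proj G) v \<ge> 2"
  shows "2 ^ (n - 1) + (1 / 2 - 1 / (2 * n)) * (n choose (n div 2)) \<le> vex n G"
proof (cases "even n")
  case True
  then have "2 ^ n + (n choose (n div 2)) \<le> 2 * vex n G"
    by (intro vex_lower_even) (use v in auto)
  then have "real (2 ^ n + (n choose (n div 2))) \<le> real (2 * vex n G)"
    by (simp only: of_nat_le_iff)
  moreover have "(2::real) ^ n = 2 * 2 ^ (n - 1)"
    using n by (simp flip: power_Suc)
  ultimately have "2 ^ (n - 1) + 1 / 2 * (n choose (n div 2)) \<le> real (vex n G)"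
    by simp
  moreover have "(1 / 2 - 1 / (2 * real n)) * (n choose (n div 2)) \<le> 1 / 2 * (n choose (n div 2))"
    by (intro mult_right_mono) auto
  ultimately show ?thesis by linarith
next
  case False
  define k where "k = n div 2"
  have nk: "n = 2 * k + 1" using False by (simp add: k_def)
  let ?C = "real (n choose k)"
  have "2 ^ (n - 1) + (n choose k) \<le> vex n G + (n - 1 choose k)"
    using nk v by (rule vex_lower_odd)
  then have "real (2 ^ (n - 1) + (n choose k)) \<le> real (vex n G + (n - 1 choose k))"
    by (simp only: of_nat_le_iff)
  then have 1: "2 ^ (n - 1) + ?C - real (n - 1 choose k) \<le> vex n G" by simp
  have "real (n - k) * ?C = real n * real (n - 1 choose k)"
    using binomial_absorb_comp[of n k] by (metis of_nat_mult)
  moreover have "real (n - k) = (n + 1) / 2" using nk by simp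
  ultimately have "(n + 1) / 2 * ?C = real n * real (n - 1 choose k)" by simp
  then have "real (n - 1 choose k) = (1 / 2 + 1 / (2 * n)) * ?C"
    using n by (simp add: field_simps)
  with 1 show ?thesis by (simp add: k_def[symmetric] algebra_simps)
qed

section \<open>The upper bound\<close>

text \<open>Any set inside \<open>M\<close> is disjoint from any set avoiding \<open>M\<close>, so
  the two sides of \<open>G\<close> can be placed arbitrarily in the two groups. Nonemptiness of the
  lower sets keeps the groups from sharing a member.\<close>

lemma contains_copy_of_butterfly:
  assumes G: "pair_graph G" "bipartite G" and s: "s = card (pverts G)"
    and F: "\<F> \<subseteq> Pow {1..n}" and M: "M \<subseteq> {1..n}"
    and lower: "s \<le> card {A \<in> \<F>. A \<noteq> {} \<and> A \<subseteq> M}"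
    and upper: "s \<le> card {B \<in> \<F>. B \<inter> M = {}}"
  shows "contains_copy (with_proj (kneser_cube n) \<restriction> \<F>) (with_proj G)"
proof -
  interpret pair_graph G by fact
  obtain U V where UV: "pverts G = U \<union> V" "U \<inter> V = {}" "parcs G \<subseteq> U \<times> V \<union> V \<times> U"
    using G(2) by (auto simp: bipartite_def)
  have finF: "finite \<F>" using F finite_subset by blast
  have fin: "finite U" "finite V"
    using pair_finite_verts UV(1) by (metis finite_Un)+
  have "card U \<le> s" "card V \<le> s"
    using s UV(1) pair_finite_verts by (auto intro!: card_mono)
  obtain a where a: "a ` U \<subseteq> {A \<in> \<F>. A \<noteq> {} \<and> A \<subseteq> M}" "inj_on a U"
    using card_le_inj[OF fin(1), of "{A \<in> \<F>. A \<noteq> {} \<and> A \<subseteq> M}"] finF lower \<open>card U \<le> s\<close>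
    by auto
  obtain b where b: "b ` V \<subseteq> {B \<in> \<F>. B \<inter> M = {}}" "inj_on b V"
    using card_le_inj[OF fin(2), of "{B \<in> \<F>. B \<inter> M = {}}"] finF upper \<open>card V \<le> s\<close>
    by auto
  let ?h = "\<lambda>x. if x \<in> U then a x else b x"
  have "a u \<noteq> b v" if "u \<in> U" "v \<in> V" for u v
    using that a(1) b(1) by blast
  then have "inj_on ?h (pverts G)"
    using a(2) b(2) UV by (auto simp: inj_on_def) metis+
  moreover have "?h ` pverts G \<subseteq> \<F>" using a b UV by auto
  moreover have "?h u \<inter> ?h v = {}" if "(u, v) \<in> parcs G" for u v
  proof (cases "u \<in> U")
    case True
    then have "v \<in> V" "v \<notin> U" using that UV by auto
    then have "a u \<subseteq> M" "b v \<inter> M = {}" using True a(1) b(1) by auto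
    then show ?thesis using True \<open>v \<notin> U\<close> by auto
  next
    case False
    then have "u \<in> V" "v \<in> U" using that UV by auto
    then have "a v \<subseteq> M" "b u \<inter> M = {}" using a(1) b(1) by auto
    then show ?thesis using False \<open>v \<in> U\<close> by auto
  qed
  ultimately show ?thesis by (intro contains_copy_kneser_cubeI G(1) F)
qed

text \<open>The excess over \<open>2 ^ (n - 1)\<close> is at most half the number of members whose
  complement is also a member. Up to complementation, these lie in a family \<open>H\<close> with
  few supersets or in the family \<open>L\<close> of very small sets.\<close>

lemma card_copy_free_le:
  assumes G: "pair_graph G" "bipartite G" and s: "s = card (pverts G)"
    and F: "\<F> \<subseteq> Pow {1..n}" and n: "n \<ge> 1" and t: "t > 0"
    and free: "\<not> contains_copy (with_proj (kneser_cube n) \<restriction> \<F>) (with_proj G)"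
  shows "card \<F> \<le> 2 ^ (n - 1) + (1 + s / t) * (n choose (n div 2)) + (\<Sum>i<s + t. n choose i)"
proof -
  define c where "c = (\<lambda>A. {1..n} - A)"
  define D where "D = {A \<in> \<F>. c A \<in> \<F>}"
  \<comment> \<open>The cut is symmetric, so that \<open>E\<close> stays closed under complement.
    Its upper half supplies the size condition of \<open>card_few_supersets\<close>, its lower half
    excludes the empty set.\<close>
  define E where "E = {A \<in> D. s + t \<le> card A \<and> card A + (s + t) \<le> n}"
  define H where "H = {A \<in> E. card {B \<in> E. A \<subset> B} \<le> s}"
  define L where "L = {A. A \<subseteq> {1..n} \<and> card A < s + t}"
  have finF: "finite \<F>" using F finite_subset by blast
  have fin: "finite D" "finite E" "finite H" "finite L"
    using finF by (auto simp: D_def E_def H_def L_def)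
  have cc: "c (c A) = A" "card (c A) = n - card A" "card A \<le> n" if "A \<subseteq> {1..n}" for A
    using that card_mono[OF _ that] by (auto simp: c_def card_Diff_subset finite_subset)
  have DS: "A \<subseteq> {1..n}" if "A \<in> D" for A using that F by (auto simp: D_def)
  have cD: "c A \<in> D" if "A \<in> D" for A
    using that cc(1)[OF DS[OF that]] by (auto simp: D_def)
  have ES: "A \<subseteq> {1..n}" if "A \<in> E" for A using that DS by (auto simp: E_def)
  have cE: "c A \<in> E" if "A \<in> E" for A
    using that cD cc(2,3)[OF ES[OF that]] by (auto simp: E_def)

  \<comment> \<open>If both \<open>A\<close> and \<open>c A\<close> had more than \<open>s\<close>
    proper supersets in \<open>E\<close>, the complements of those of \<open>c A\<close> would be
    nonempty subsets of \<open>A\<close> and the complements of those of \<open>A\<close> would be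
    disjoint from \<open>A\<close>; all of them belong to the family, so a copy of \<open>G\<close>
    would appear.\<close>
  have EH: "A \<in> H \<union> c ` H" if A: "A \<in> E" for A
  proof (rule ccontr)
    assume contra: "A \<notin> H \<union> c ` H"
    have "c A \<notin> H" using contra cc(1)[OF ES[OF A]] by (auto intro!: rev_image_eqI)
    then have l: "s < card {B \<in> E. c A \<subset> B}" using cE[OF A] by (auto simp: H_def)
    have u: "s < card {B \<in> E. A \<subset> B}" using contra A by (auto simp: H_def)
    have injc: "inj_on c X" if "X \<subseteq> E" for X
      by (rule inj_on_inverseI[of _ c]) (use that ES cc in auto)
    have pos: "B \<noteq> {}" if "B \<in> E" for B
      using that t by (auto simp: E_def)
    have EF: "B \<in> \<F>" if "B \<in> E" for B using that by (auto simp: E_def D_def)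
    have "contains_copy (with_proj (kneser_cube n) \<restriction> \<F>) (with_proj G)"
    proof (rule contains_copy_of_butterfly[OF G s F ES[OF A]])
      have "c ` {B \<in> E. c A \<subset> B} \<subseteq> {B \<in> \<F>. B \<noteq> {} \<and> B \<subseteq> A}"
        using cE EF pos by (auto simp: c_def)
      from card_mono[OF _ this] show "s \<le> card {B \<in> \<F>. B \<noteq> {} \<and> B \<subseteq> A}"
        using l finF by (simp add: card_image injc)
      have "c ` {B \<in> E. A \<subset> B} \<subseteq> {B \<in> \<F>. B \<inter> A = {}}"
        using cE EF by (auto simp: c_def)
      from card_mono[OF _ this] show "s \<le> card {B \<in> \<F>. B \<inter> A = {}}"
        using u finF by (simp add: card_image injc)
    qed
    with free show False by simp
  qed
  have "D \<subseteq> (H \<union> c ` H) \<union> (L \<union> c ` L)"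
  proof
    fix A assume A: "A \<in> D"
    consider "A \<in> E" | "card A < s + t" | "n < card A + (s + t)"
      using A by (force simp: E_def)
    then show "A \<in> (H \<union> c ` H) \<union> (L \<union> c ` L)"
    proof cases
      case 1
      then show ?thesis using EH by blast
    next
      case 2
      then show ?thesis using DS[OF A] by (auto simp: L_def)
    next
      case 3
      then have "c A \<in> L" using cc[OF DS[OF A]] by (auto simp: L_def c_def)
      then show ?thesis using cc(1)[OF DS[OF A]] by (auto intro!: rev_image_eqI)
    qed
  qed
  then have "card D \<le> card ((H \<union> c ` H) \<union> (L \<union> c ` L))"
    using fin by (intro card_mono) auto
  also have "\<dots> \<le> (card H + card (c ` H)) + (card L + card (c ` L))"
    by (meson add_mono card_Un_le le_trans)
  also have "\<dots> \<le> 2 * card H + 2 * card L"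
    using card_image_le[OF fin(3), of c] card_image_le[OF fin(4), of c] by simp
  finally have D: "card D \<le> 2 * card H + 2 * card L" .
  have "card (\<F> \<union> c ` \<F>) \<le> card (Pow {1..n})"
    using F by (intro card_mono) (auto simp: c_def)
  then have "2 * card \<F> \<le> 2 ^ n + card D"
    using two_card_family[of "{1..n}" \<F>] F by (simp add: card_Pow c_def D_def)
  moreover have "(2::nat) ^ n = 2 * 2 ^ (n - 1)"
    using n by (simp flip: power_Suc)
  ultimately have "card \<F> \<le> 2 ^ (n - 1) + card H + card L"
    using D by linarith
  then have "real (card \<F>) \<le> real (2 ^ (n - 1) + card H + card L)"
    by (simp only: of_nat_le_iff)
  moreover have "real (card H) \<le> (1 + s / t) * (n choose (n div 2))"
  proof -
    have "card {B \<in> H. A \<subset> B} \<le> s" if "A \<in> H" for A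
    proof -
      have "card {B \<in> H. A \<subset> B} \<le> card {B \<in> E. A \<subset> B}"
        using fin by (intro card_mono) (auto simp: H_def)
      then show ?thesis using that by (auto simp: H_def)
    qed
    then show ?thesis
      using card_few_supersets[of "{1..n}" H s t] ES t by (auto simp: H_def E_def)
  qed
  moreover have "card L = (\<Sum>i<s + t. n choose i)"
  proof -
    have "L = (\<Union>i<s + t. {A. A \<subseteq> {1..n} \<and> card A = i})" by (auto simp: L_def)
    then have "card L = (\<Sum>i<s + t. card {A. A \<subseteq> {1..n} \<and> card A = i})"
      by (simp only:) (rule card_UN_disjoint, auto)
    then show ?thesis using n_subsets[of "{1..n}"] by simp
  qed
  ultimately show ?thesis by simp
qed

section \<open>Asymptotics\<close>

lemma two_power_le_central_binomial: "2 ^ n \<le> (n + 1) * (n choose (n div 2))"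
proof -
  have "(2::nat) ^ n = (\<Sum>i\<le>n. n choose i)" by (simp add: choose_row_sum)
  also have "\<dots> \<le> (\<Sum>i\<le>n. n choose (n div 2))" by (intro sum_mono binomial_maximum)
  finally show ?thesis by simp
qed

text \<open>For fixed \<open>i\<close> the numerator is at most \<open>n ^ i\<close>, whereas the
  central binomial is at least the average \<open>2 ^ n / (n + 1)\<close> of its row.\<close>

lemma choose_over_central_binomial:
  "(\<lambda>n. real (n choose i) / real (n choose (n div 2))) \<longlonglongrightarrow> 0"
proof (rule tendsto_sandwich)
  show "(\<lambda>_. 0::real) \<longlonglongrightarrow> 0"
    by simp
  show "(\<lambda>n. real n ^ i * (real n + 1) / 2 ^ n) \<longlonglongrightarrow> 0"
    by real_asymp
  show "\<forall>\<^sub>F n in sequentially. real (n choose i) / real (n choose (n div 2)) \<le>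
      real n ^ i * (real n + 1) / 2 ^ n"
  proof (rule always_eventually, rule allI)
    fix n
    let ?C = "real (n choose (n div 2))"
    have "n choose i \<le> n ^ i"
      by (cases "i \<le> n") (auto intro: binomial_le_pow simp: binomial_eq_0)
    then have 1: "real (n choose i) \<le> real n ^ i" by (metis of_nat_le_iff of_nat_power)
    have "real (2 ^ n) \<le> real ((n + 1) * (n choose (n div 2)))"
      using two_power_le_central_binomial by (simp only: of_nat_le_iff)
    then have 2: "2 ^ n \<le> (real n + 1) * ?C" by (simp add: algebra_simps)
    have "real (n choose i) * 2 ^ n \<le> real n ^ i * ((real n + 1) * ?C)"
      using 1 2 by (intro mult_mono) auto
    then show "real (n choose i) / ?C \<le> real n ^ i * (real n + 1) / 2 ^ n"
      by (simp add: field_simps)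
  qed
qed auto

lemma vex_upper_eventually:
  fixes \<epsilon> :: real
  assumes G: "pair_graph G" "bipartite G" "pverts G \<noteq> {}" and \<epsilon>: "\<epsilon> > 0"
  shows "\<forall>\<^sub>F n in sequentially. vex n G \<le> 2 ^ (n - 1) + (1 + \<epsilon>) * (n choose (n div 2))"
proof -
  define s where "s = card (pverts G)"
  \<comment> \<open>Half of \<epsilon> pays for \<open>s / t\<close>. As \<open>s + t\<close> is now
    independent of \<open>n\<close>, the other half pays for the sum of small binomials once
    \<open>n\<close> is large.\<close>
  obtain t :: nat where t: "2 * s / \<epsilon> < t" using reals_Archimedean2 by blast
  have "0 \<le> 2 * s / \<epsilon>" using \<epsilon> by simp
  then have t0: "t > 0" using t by (metis of_nat_0_less_iff order_le_less_trans)
  have st: "s / t \<le> \<epsilon> / 2" using t t0 \<epsilon> by (simp add: field_simps)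
  have "(\<lambda>n. \<Sum>i<s + t. real (n choose i) / real (n choose (n div 2))) \<longlonglongrightarrow> (\<Sum>i<s + t. 0)"
    by (intro tendsto_sum choose_over_central_binomial)
  then have "\<forall>\<^sub>F n in sequentially.
      (\<Sum>i<s + t. real (n choose i) / real (n choose (n div 2))) < \<epsilon> / 2"
    using \<epsilon> by (intro order_tendstoD(2)) auto
  with eventually_ge_at_top[of 1] show ?thesis
  proof eventually_elim
    case (elim n)
    let ?C = "real (n choose (n div 2))"
    obtain \<F> where \<F>: "\<F> \<subseteq> Pow {1..n}" "card \<F> = vex n G"
        "\<not> contains_copy (with_proj (kneser_cube n) \<restriction> \<F>) (with_proj G)"
      using G(3) by (rule vex_attained)
    have "vex n G \<le> 2 ^ (n - 1) + (1 + s / t) * ?C + (\<Sum>i<s + t. n choose i)"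
      using card_copy_free_le[OF G(1,2) s_def \<F>(1) elim(1) t0 \<F>(3)] \<F>(2) by simp
    moreover have "(1 + s / t) * ?C \<le> (1 + \<epsilon> / 2) * ?C"
      using st by (intro mult_right_mono) auto
    moreover have "real (\<Sum>i<s + t. n choose i) \<le> \<epsilon> / 2 * ?C"
      using elim(2) by (simp add: pos_divide_less_eq less_imp_le flip: sum_divide_distrib)
    moreover have "(1 + \<epsilon>) * ?C = (1 + \<epsilon> / 2) * ?C + \<epsilon> / 2 * ?C"
      by (simp add: algebra_simps)
    ultimately show ?case by linarith
  qed
qed

theorem theorem2:
  fixes G :: "'a pair_pre_digraph"
  assumes "pair_graph G"
    and "bipartite G"
    and "\<exists>v \<in> pverts G. out_degree (with_proj G) v \<ge> 2"
  shows "\<exists>f g :: nat \<Rightarrow> real. f \<in> o(\<lambda>_. 1) \<and> g \<in> o(\<lambda>_. 1) \<and>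
    (\<forall>n\<ge>1. 2 ^ (n - 1) + (1 / 2 - f n) * real (n choose (n div 2)) \<le> real (vex n G) \<and>
           real (vex n G) \<le> 2 ^ (n - 1) + (1 + g n) * real (n choose (n div 2)))"
proof -
  obtain v where v: "v \<in> pverts G" "out_degree (with_proj G) v \<ge> 2" using assms(3) by blast
  then have ne: "pverts G \<noteq> {}" by blast
  \<comment> \<open>The exact normalized excess makes the upper bound hold for every
    \<open>n\<close>, not only eventually. Truncation at 0 reduces
    \<open>g \<longlonglongrightarrow> 0\<close> to the eventual upper estimate.\<close>
  define g where "g n = max 0 ((real (vex n G) - 2 ^ (n - 1)) / real (n choose (n div 2)) - 1)" for n
  have C: "real (n choose (n div 2)) > 0" for n by simp
  have "(\<lambda>n. 1 / (2 * real n)) \<in> o(\<lambda>_. 1)" by real_asymp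
  moreover have "g \<longlonglongrightarrow> 0"
  proof (rule tendstoI)
    fix e :: real assume e: "e > 0"
    then have "\<forall>\<^sub>F n in sequentially. vex n G \<le> 2 ^ (n - 1) + (1 + e / 2) * (n choose (n div 2))"
      by (intro vex_upper_eventually assms(1,2) ne) simp
    then show "\<forall>\<^sub>F n in sequentially. dist (g n) 0 < e"
    proof eventually_elim
      case (elim n)
      then have "(real (vex n G) - 2 ^ (n - 1)) / real (n choose (n div 2)) \<le> 1 + e / 2"
        by (simp add: pos_divide_le_eq)
      then show ?case using e by (simp add: g_def)
    qed
  qed
  then have "g \<in> o(\<lambda>_. 1)" by (intro smalloI_tendsto) auto
  moreover have "real (vex n G) \<le> 2 ^ (n - 1) + (1 + g n) * real (n choose (n div 2))" for n
  proof -
    have "(real (vex n G) - 2 ^ (n - 1)) / real (n choose (n div 2)) \<le> 1 + g n"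
      by (simp add: g_def)
    then show ?thesis by (simp add: pos_divide_le_eq)
  qed
  ultimately show ?thesis
    using vex_lower[OF _ v] by blast
qed

end
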